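(* Let $\varepsilon\in(0,1)$, let $\mathcal{E}$ be a finite set of elements, $\mathcal{F}$ a set of subsets of $\mathcal{E}$ (strategies), and $m=\max_{f\in\mathcal{F}}|f|$. Let $\mathcal{A}$ be a full information algorithm for the problem such that, for every $L>0$, its expected $(\varepsilon/3)$-approximate regret against any $f\in\mathcal{F}$ is bounded by $L\cdot B(\varepsilon,T,\mathcal{F})$ when run on strategy losses bounded by $L$. Then, in the combinatorial semi-bandit protocol, the Semi-Bandit Freezing Algorithm run with learning parameter $\varepsilon'=\varepsilon/3$ on input $\mathcal{A}$ guarantees that for any $\delta>0$, with probability at least $1-\delta$, for all $f\in\mathcal{F}$, $$(1-\varepsilon)\sum_{t=1}^T\ell^t_{I(t)}-\sum_{t=1}^T\ell_f^t\le\frac{9m|\mathcal{E}|\log(|\mathcal{E}|/\delta)}{\varepsilon^2}+\frac{3m|\mathcal{E}|\,B(\varepsilon,T,\mathcal{F})}{\varepsilon}.$$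
   Context: **Semi-bandit protocol.** In each round $t=1,\dots,T$ the learner picks a distribution $w^t$ on $\mathcal{F}$; the adversary picks element losses $\ell_e^t\in[0,1]$, $e\in\mathcal{E}$ (possibly depending on the past, in particular on $I(1),\dots,I(t-1)$, but not on $I(t)$); the learner draws $I(t)\in\mathcal{F}$ from $w^t$, suffers $\ell^t_{I(t)}$, and observes $\ell_e^t$ for all $e\in I(t)$. For a strategy $f\in\mathcal F$, $\ell_f^t=\sum_{e\in f}\ell_e^t$. **Full information algorithm.** It outputs in each round a distribution $p^t$ on $\mathcal{F}$ as a function of past full vectors of (nonnegative) element losses $\widetilde\ell_e$; its expected $\varepsilon$-approximate regret against $f$ is $(1-\varepsilon)\sum_t\sum_{i\in\mathcal{F}}p_i^t\widetilde\ell_i^t-\sum_t\widetilde\ell_f^t$, where $\widetilde\ell_i^t=\sum_{e\in i}\widetilde\ell_e^t$. **Semi-Bandit Freezing Algorithm** (input $\mathcal{A}$, learning parameter $\varepsilon'$, threshold $\gamma=\varepsilon'/|\mathcal{E}|$). In each round $t$, with $p^t$ given by $\mathcal{A}$: (1) start with $F^t_{\mathrm{Elem}}=\emptyset$, $F^t_{\mathrm{Str}}=\emptyset$ and repeat until stable: add to $F^t_{\mathrm{Elem}}$ every $e\in\mathcal{E}$ with $\sum_{i\in\mathcal{F}\setminus F^t_{\mathrm{Str}},\,e\in i}p_i^t<\gamma$, and add to $F^t_{\mathrm{Str}}$ every strategy containing an element of $F^t_{\mathrm{Elem}}$; (2) $w_i^t=0$ if $i\in F^t_{\mathrm{Str}}$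 and $w_i^t=p_i^t/(1-\sum_{j\in F^t_{\mathrm{Str}}}p_j^t)$ otherwise; (3) draw $I(t)\sim w^t$; (4) $\widetilde\ell_e^t=\ell_e^t/W_e^t$ with $W_e^t=\sum_{i\ni e}w_i^t$ if $e\in I(t)$, and $\widetilde\ell_e^t=0$ otherwise; (5) feed $\widetilde\ell^t$ to $\mathcal{A}$ to get $p^{t+1}$. Observation probabilities are assumed to be computed exactly. *)

theory Defs
  imports "HOL-Probability.Probability" "HOL-Library.While_Combinator"
begin

text \<open>
  Elements have type \<open>'e\<close>; a strategy is a set of elements. A vector of losses indexed by a
  finite set \<open>E\<close> is a function on \<open>'e\<close> that vanishes off \<open>E\<close>.
\<close>

definition loss_vectors :: "'e set \<Rightarrow> ('e \<Rightarrow> real) set" where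
  "loss_vectors E = {x. (\<forall>e\<in>E. 0 \<le> x e) \<and> (\<forall>e. e \<notin> E \<longrightarrow> x e = 0)}"

definition strategy_loss :: "('e \<Rightarrow> real) \<Rightarrow> 'e set \<Rightarrow> real" where
  "strategy_loss x f = (\<Sum>e\<in>f. x e)"

text \<open>
  A full information algorithm maps the list \<open>[x 1, \<dots>, x (t - 1)]\<close> of the past loss vectors to
  the distribution of round \<open>t\<close>. Lists are chronological.
\<close>

type_synonym 'e full_info_alg = "('e \<Rightarrow> real) list \<Rightarrow> 'e set pmf"

definition full_info_algorithm :: "'e set \<Rightarrow> 'e set set \<Rightarrow> 'e full_info_alg \<Rightarrow> bool" where
  "full_info_algorithm E F A \<longleftrightarrow> (\<forall>h. set h \<subseteq> loss_vectors E \<longrightarrow> set_pmf (A h) \<subseteq> F)"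

definition expected_approx_regret ::
    "'e set set \<Rightarrow> 'e full_info_alg \<Rightarrow> real \<Rightarrow> nat \<Rightarrow> (nat \<Rightarrow> 'e \<Rightarrow> real) \<Rightarrow> 'e set \<Rightarrow> real" where
  "expected_approx_regret F A \<epsilon> T x f =
     (1 - \<epsilon>) * (\<Sum>t=1..T. \<Sum>i\<in>F. pmf (A (map x [1..<t])) i * strategy_loss (x t) i)
       - (\<Sum>t=1..T. strategy_loss (x t) f)"

text \<open>
  The combinatorial semi-bandit protocol. The \<open>\<sigma>\<close>-algebra \<open>G t\<close> contains everything that has
  happened in round \<open>t\<close> before the draw of \<open>I t\<close>: the draws \<open>I 1, \<dots>, I (t - 1)\<close>, the distribution
  \<open>w t\<close> and the losses \<open>l t\<close>, together with any randomness the adversary has used so far. The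
  adversary is thus adaptive and possibly randomised. That \<open>I t\<close> is drawn from \<open>w t\<close>, with the
  losses of round \<open>t\<close> not depending on the outcome, is the statement that \<open>w t\<close> is the conditional
  law of \<open>I t\<close> given \<open>G t\<close>.
\<close>

locale semi_bandit_protocol = prob_space M + filtration "space M" G
  for M :: "'m measure" and G :: "nat \<Rightarrow> 'm measure" +
  fixes E :: "'e set" and F :: "'e set set" and T :: nat
    and w :: "nat \<Rightarrow> 'm \<Rightarrow> 'e set \<Rightarrow> real"
    and l :: "nat \<Rightarrow> 'm \<Rightarrow> 'e \<Rightarrow> real"
    and I :: "nat \<Rightarrow> 'm \<Rightarrow> 'e set"
  assumes subalg: "\<And>t. subalgebra M (G t)"
    and distr_measurable:
      "\<And>t f. t \<in> {1..T} \<Longrightarrow> f \<in> F \<Longrightarrow> (\<lambda>\<omega>. w t \<omega> f) \<in> borel_measurable (G t)"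
    and loss_measurable:
      "\<And>t e. t \<in> {1..T} \<Longrightarrow> e \<in> E \<Longrightarrow> (\<lambda>\<omega>. l t \<omega> e) \<in> borel_measurable (G t)"
    and loss_range:
      "\<And>t e \<omega>. t \<in> {1..T} \<Longrightarrow> e \<in> E \<Longrightarrow> \<omega> \<in> space M \<Longrightarrow> l t \<omega> e \<in> {0..1}"
    and draw_measurable:
      "\<And>t. t \<in> {1..T} \<Longrightarrow> I t \<in> G (Suc t) \<rightarrow>\<^sub>M count_space F"
    and draw_law:
      "\<And>t f. t \<in> {1..T} \<Longrightarrow> f \<in> F \<Longrightarrow>
         AE \<omega> in M. real_cond_exp M (G t) (indicator {\<omega> \<in> space M. I t \<omega> = f}) \<omega> = w t \<omega> f"

text \<open>
  Freezing. A state is the pair of the frozen elements and the frozen strategies; \<open>p\<close> gives the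
  probabilities of the strategies.
\<close>

definition freeze_step ::
    "'e set \<Rightarrow> 'e set set \<Rightarrow> real \<Rightarrow> ('e set \<Rightarrow> real) \<Rightarrow> 'e set \<times> 'e set set \<Rightarrow> 'e set \<times> 'e set set" where
  "freeze_step E F \<gamma> p s =
     (let FElem = fst s \<union> {e \<in> E. (\<Sum>i | i \<in> F - snd s \<and> e \<in> i. p i) < \<gamma>};
          FStr = snd s \<union> {i \<in> F. i \<inter> FElem \<noteq> {}}
      in (FElem, FStr))"

definition frozen ::
    "'e set \<Rightarrow> 'e set set \<Rightarrow> real \<Rightarrow> ('e set \<Rightarrow> real) \<Rightarrow> 'e set \<times> 'e set set" where
  "frozen E F \<gamma> p =
     while (\<lambda>s. freeze_step E F \<gamma> p s \<noteq> s) (freeze_step E F \<gamma> p) ({}, {})"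

definition frozen_strategies ::
    "'e set \<Rightarrow> 'e set set \<Rightarrow> real \<Rightarrow> ('e set \<Rightarrow> real) \<Rightarrow> 'e set set" where
  "frozen_strategies E F \<gamma> p = snd (frozen E F \<gamma> p)"

definition freezing_distr ::
    "'e set \<Rightarrow> 'e set set \<Rightarrow> real \<Rightarrow> ('e set \<Rightarrow> real) \<Rightarrow> 'e set \<Rightarrow> real" where
  "freezing_distr E F \<gamma> p i =
     (if i \<in> frozen_strategies E F \<gamma> p then 0
      else p i / (1 - (\<Sum>j\<in>frozen_strategies E F \<gamma> p. p j)))"

definition observation_prob :: "'e set set \<Rightarrow> ('e set \<Rightarrow> real) \<Rightarrow> 'e \<Rightarrow> real" where
  "observation_prob F w e = (\<Sum>i | i \<in> F \<and> e \<in> i. w i)"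

definition estimated_loss ::
    "'e set set \<Rightarrow> ('e set \<Rightarrow> real) \<Rightarrow> ('e \<Rightarrow> real) \<Rightarrow> 'e set \<Rightarrow> 'e \<Rightarrow> real" where
  "estimated_loss F w l i e = (if e \<in> i then l e / observation_prob F w e else 0)"

text \<open>
  One run of the Semi-Bandit Freezing Algorithm, for the actual losses \<open>l t\<close> and draws \<open>i t\<close> of the
  rounds \<open>t \<ge> 1\<close>: \<open>sbf_history \<dots> n\<close> is the list of the estimated loss vectors of the rounds
  \<open>1, \<dots>, n\<close>, and \<open>sbf_distr \<dots> t\<close> is the distribution used in round \<open>t\<close>. Both read \<open>l t\<close> only on
  the observed elements \<open>i t\<close>.
\<close>

definition sbf_distr_from ::
    "'e set \<Rightarrow> 'e set set \<Rightarrow> 'e full_info_alg \<Rightarrow> real \<Rightarrow> ('e \<Rightarrow> real) list \<Rightarrow> 'e set \<Rightarrow> real" where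
  "sbf_distr_from E F A \<epsilon>' h = freezing_distr E F (\<epsilon>' / real (card E)) (pmf (A h))"

primrec sbf_history ::
    "'e set \<Rightarrow> 'e set set \<Rightarrow> 'e full_info_alg \<Rightarrow> real
     \<Rightarrow> (nat \<Rightarrow> 'e \<Rightarrow> real) \<Rightarrow> (nat \<Rightarrow> 'e set) \<Rightarrow> nat \<Rightarrow> ('e \<Rightarrow> real) list" where
  "sbf_history E F A \<epsilon>' l i 0 = []"
| "sbf_history E F A \<epsilon>' l i (Suc n) =
     (let h = sbf_history E F A \<epsilon>' l i n
      in h @ [estimated_loss F (sbf_distr_from E F A \<epsilon>' h) (l (Suc n)) (i (Suc n))])"

definition sbf_distr ::
    "'e set \<Rightarrow> 'e set set \<Rightarrow> 'e full_info_alg \<Rightarrow> real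
     \<Rightarrow> (nat \<Rightarrow> 'e \<Rightarrow> real) \<Rightarrow> (nat \<Rightarrow> 'e set) \<Rightarrow> nat \<Rightarrow> 'e set \<Rightarrow> real" where
  "sbf_distr E F A \<epsilon>' l i t = sbf_distr_from E F A \<epsilon>' (sbf_history E F A \<epsilon>' l i (t - 1))"

end

theory Submission
  imports Defs
begin

text \<open>
  Write \<open>x = \<epsilon> / 3\<close>, \<open>d\<close> for the number of elements and \<open>\<gamma> = x / d\<close>. Each frozen element removes mass below
  \<open>\<gamma>\<close>, so less than \<open>x\<close> is frozen in total and \<open>(1 - x) w \<le> p\<close>. Every element of a drawn strategy is
  observed with probability at least \<open>\<gamma>\<close>, so strategies have estimated losses at most \<open>m / \<gamma>\<close>. As the
  \<open>w\<close>-average of the estimated losses is exactly the incurred loss, the full information guarantee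
  bounds \<open>(1 - x)\<^sup>2\<close> times the incurred loss by the estimated loss of any \<open>f\<close> plus \<open>(m / \<gamma>) B\<close>, on
  almost every path.

  Only the estimates are random. For each element, the exponential supermartingale with parameter
  \<open>c = ln (1 + x)\<close> shows that, outside an event of probability \<open>\<delta> / d\<close>, \<open>c\<close> times the estimated
  loss is at most \<open>x\<close> times the true loss plus \<open>ln (d / \<delta>) / \<gamma>\<close>. A union bound over elements, rather than
  strategies, gives all \<open>f\<close> at once, and \<open>x / (1 + x) \<le> c \<le> x\<close> turns the factors into \<open>1 - 3 x\<close>.
\<close>

subsection \<open>Freezing\<close>

text \<open>A strategy frozen in this step meets no old frozen element, so it contains a new one.
  Before the step, the unfrozen strategies through a new element had mass below \<gamma>, so a union
  bound charges the added mass to the new elements.\<close>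

lemma freeze_step_invariant:
  fixes p :: "'e set \<Rightarrow> real" and \<gamma> :: real
  assumes "finite E" "finite F" and p: "\<And>i. 0 \<le> p i"
    and s: "fst s \<subseteq> E" "snd s = {i \<in> F. i \<inter> fst s \<noteq> {}}"
      "(\<Sum>i\<in>snd s. p i) \<le> real (card (fst s)) * \<gamma>"
  defines "s' \<equiv> freeze_step E F \<gamma> p s"
  shows "fst s \<subseteq> fst s'" "fst s' \<subseteq> E" "snd s' = {i \<in> F. i \<inter> fst s' \<noteq> {}}"
    "(\<Sum>i\<in>snd s'. p i) \<le> real (card (fst s')) * \<gamma>"
proof -
  \<comment> \<open>Old frozen elements may pass the threshold test again; removing them makes the
    number of frozen elements grow by exactly \<open>card N\<close>.\<close>
  define N where "N = {e \<in> E. (\<Sum>i | i \<in> F - snd s \<and> e \<in> i. p i) < \<gamma>} - fst s"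
  have fst': "fst s' = fst s \<union> N"
    by (auto simp: s'_def freeze_step_def Let_def N_def)
  show snd': "snd s' = {i \<in> F. i \<inter> fst s' \<noteq> {}}"
    unfolding s'_def freeze_step_def Let_def by (auto simp: s(2))
  show "fst s \<subseteq> fst s'" "fst s' \<subseteq> E"
    using s(1) by (auto simp: fst' N_def)
  have fin: "finite (fst s)" "finite N"
    using assms finite_subset by (auto simp: N_def)
  have fins: "finite (snd s)"
    using assms(2) by (simp add: s(2))
  have new: "snd s' - snd s \<subseteq> (\<Union>e\<in>N. {i. i \<in> F - snd s \<and> e \<in> i})"
    by (auto simp: snd' s(2) fst')
  have sub: "snd s \<subseteq> snd s'"
    by (auto simp: snd' s(2) fst')
  have "(\<Sum>i\<in>snd s' - snd s. p i) \<le> (\<Sum>i\<in>(\<Union>e\<in>N. {i. i \<in> F - snd s \<and> e \<in> i}). p i)"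
    using new fin assms(2) p by (intro sum_mono2) auto
  also have "\<dots> \<le> (\<Sum>e\<in>N. \<Sum>i | i \<in> F - snd s \<and> e \<in> i. p i)"
    using fin(2)
  proof (induction N rule: finite_induct)
    case (insert e N)
    have "(\<Sum>i\<in>{i. i \<in> F - snd s \<and> e \<in> i} \<union> (\<Union>e\<in>N. {i. i \<in> F - snd s \<and> e \<in> i}). p i)
      \<le> (\<Sum>i\<in>{i. i \<in> F - snd s \<and> e \<in> i}. p i) + (\<Sum>i\<in>(\<Union>e\<in>N. {i. i \<in> F - snd s \<and> e \<in> i}). p i)"
      using assms(2) insert.hyps p by (subst sum_Un) (auto intro!: sum_nonneg)
    then show ?case
      using insert by simp
  qed simp
  also have "\<dots> \<le> (\<Sum>e\<in>N. \<gamma>)"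
    by (intro sum_mono) (auto simp: N_def)
  finally have "(\<Sum>i\<in>snd s' - snd s. p i) \<le> real (card N) * \<gamma>"
    by simp
  moreover have "(\<Sum>i\<in>snd s'. p i) = (\<Sum>i\<in>snd s' - snd s. p i) + (\<Sum>i\<in>snd s. p i)"
    using sub assms(2) by (intro sum.subset_diff) (auto simp: snd')
  moreover have "card (fst s') = card (fst s) + card N"
    unfolding fst' using fin by (intro card_Un_disjoint) (auto simp: N_def)
  ultimately show "(\<Sum>i\<in>snd s'. p i) \<le> real (card (fst s')) * \<gamma>"
    using s(3) by (simp add: algebra_simps)
qed

lemma frozen_fixpoint:
  fixes p :: "'e set \<Rightarrow> real" and \<gamma> :: real
  assumes "finite E" "finite F" and p: "\<And>i. 0 \<le> p i"
  defines "s \<equiv> frozen E F \<gamma> p"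
  shows "freeze_step E F \<gamma> p s = s" "fst s \<subseteq> E" "snd s = {i \<in> F. i \<inter> fst s \<noteq> {}}"
    "(\<Sum>i\<in>snd s. p i) \<le> real (card (fst s)) * \<gamma>"
proof -
  define P where "P s \<longleftrightarrow> fst s \<subseteq> E \<and> snd s = {i \<in> F. i \<inter> fst s \<noteq> {}} \<and>
    (\<Sum>i\<in>snd s. p i) \<le> real (card (fst s)) * \<gamma>" for s
  have step: "P (freeze_step E F \<gamma> p s) \<and> fst s \<subseteq> fst (freeze_step E F \<gamma> p s)" if s: "P s" for s
  proof -
    have "fst s \<subseteq> E" "snd s = {i \<in> F. i \<inter> fst s \<noteq> {}}"
      "(\<Sum>i\<in>snd s. p i) \<le> real (card (fst s)) * \<gamma>"
      using s unfolding P_def by blast+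
    note freeze_step_invariant[where p = p and \<gamma> = \<gamma> and s = s, OF assms(1,2) p this]
    then show ?thesis
      unfolding P_def by (intro conjI)
  qed
  have snd_eq: "snd s = {i \<in> F. i \<inter> fst s \<noteq> {}}" and fst_sub: "fst s \<subseteq> E" if "P s" for s
    using that unfolding P_def by blast+
  have "(\<lambda>s. P s \<and> freeze_step E F \<gamma> p s = s) s"
    unfolding s_def frozen_def
  proof (rule while_rule2[where P = P and r = "Wellfounded.measure (\<lambda>s. card E - card (fst s))"])
    fix s assume s: "P s" "freeze_step E F \<gamma> p s \<noteq> s"
    let ?s = "freeze_step E F \<gamma> p s"
    have s': "P ?s" "fst s \<subseteq> fst ?s"
      using step[OF s(1)] by blast+
    have "fst s \<noteq> fst ?s"
    proof
      assume "fst s = fst ?s"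
      moreover from this have "snd s = snd ?s"
        unfolding snd_eq[OF s(1)] snd_eq[OF s'(1)] by (simp only:)
      ultimately show False
        using s(2) by (metis prod_eq_iff)
    qed
    moreover have "fst ?s \<subseteq> E"
      using fst_sub[OF s'(1)] .
    ultimately have "card (fst s) < card (fst ?s)" "card (fst ?s) \<le> card E"
      using s'(2) assms(1) by (auto intro!: psubset_card_mono card_mono intro: finite_subset)
    then show "P ?s \<and> (?s, s) \<in> Wellfounded.measure (\<lambda>s. card E - card (fst s))"
      using s'(1) by simp
  next
    show "P ({}, {})"
      by (simp add: P_def)
  qed simp_all
  then show "freeze_step E F \<gamma> p s = s" "fst s \<subseteq> E" "snd s = {i \<in> F. i \<inter> fst s \<noteq> {}}"
    "(\<Sum>i\<in>snd s. p i) \<le> real (card (fst s)) * \<gamma>"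
    unfolding P_def by blast+
qed

context
  fixes E :: "'e set" and F :: "'e set set" and p :: "'e set \<Rightarrow> real" and \<gamma> :: real
  assumes finite_E: "finite E" and F_sub: "F \<subseteq> Pow E"
    and p_nonneg: "\<And>i. 0 \<le> p i"
    and \<gamma>_pos: "0 < \<gamma>" and \<gamma>_small: "real (card E) * \<gamma> < 1"
begin

private lemma finite_F: "finite F"
  using finite_E F_sub finite_subset by auto

lemma frozen_mass:
  "(\<Sum>j\<in>frozen_strategies E F \<gamma> p. p j) \<in> {0..real (card E) * \<gamma>}"
proof -
  note frz = frozen_fixpoint[where p = p and \<gamma> = \<gamma>, OF finite_E finite_F p_nonneg]
  have "real (card (fst (frozen E F \<gamma> p))) * \<gamma> \<le> real (card E) * \<gamma>"
    using frz(2) finite_E \<gamma>_pos by (intro mult_right_mono) (auto intro: card_mono)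
  then show ?thesis
    using frz(4) by (auto simp: frozen_strategies_def intro: sum_nonneg p_nonneg)
qed

lemma freezing_distr_nonneg: "0 \<le> freezing_distr E F \<gamma> p i"
  using frozen_mass p_nonneg \<gamma>_small by (auto simp: freezing_distr_def)

lemma freezing_distr_le:
  "(1 - real (card E) * \<gamma>) * freezing_distr E F \<gamma> p i \<le> p i"
proof (cases "i \<in> frozen_strategies E F \<gamma> p")
  case False
  have "(1 - real (card E) * \<gamma>) * (p i / (1 - q)) \<le> p i"
    if "q \<in> {0..real (card E) * \<gamma>}" for q
  proof -
    have "(1 - real (card E) * \<gamma>) * p i \<le> (1 - q) * p i"
      using that p_nonneg by (intro mult_right_mono) auto
    then show ?thesis
      using that \<gamma>_small by (simp add: field_simps)
  qed
  then show ?thesis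
    using False frozen_mass by (simp add: freezing_distr_def)
qed (simp add: freezing_distr_def p_nonneg)

text \<open>A strategy of nonzero weight is unfrozen, so it contains no frozen element. At the
  fixpoint every unfrozen element has mass at least \<gamma> on the unfrozen strategies, and
  renormalisation only increases this mass.\<close>

lemma observation_prob_ge:
  assumes i: "i \<in> F" "freezing_distr E F \<gamma> p i \<noteq> 0" "e \<in> i"
  shows "\<gamma> \<le> observation_prob F (freezing_distr E F \<gamma> p) e"
proof -
  let ?S = "frozen_strategies E F \<gamma> p"
  define q where "q = (\<Sum>j\<in>?S. p j)"
  have q: "0 \<le> q" "q < 1"
    using frozen_mass \<gamma>_small by (auto simp: q_def)
  note frz = frozen_fixpoint[where p = p and \<gamma> = \<gamma>, OF finite_E finite_F p_nonneg]
  have "i \<notin> ?S"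
    using i(2) by (auto simp: freezing_distr_def)
  then have "e \<notin> fst (frozen E F \<gamma> p)"
    using i frz(3) by (auto simp: frozen_strategies_def)
  then have "e \<notin> fst (freeze_step E F \<gamma> p (frozen E F \<gamma> p))"
    using frz(1) by simp
  then have "\<gamma> \<le> (\<Sum>i | i \<in> F - ?S \<and> e \<in> i. p i)"
    using i F_sub by (auto simp: freeze_step_def Let_def frozen_strategies_def)
  also have "\<dots> \<le> (\<Sum>i | i \<in> F - ?S \<and> e \<in> i. freezing_distr E F \<gamma> p i)"
  proof (intro sum_mono)
    fix i assume "i \<in> {i. i \<in> F - ?S \<and> e \<in> i}"
    moreover have "p i \<le> p i / (1 - q)"
      using q p_nonneg[of i] by (auto simp: pos_le_divide_eq algebra_simps)
    ultimately show "p i \<le> freezing_distr E F \<gamma> p i"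
      by (simp add: freezing_distr_def q_def)
  qed
  also have "\<dots> \<le> observation_prob F (freezing_distr E F \<gamma> p) e"
    unfolding observation_prob_def using finite_F freezing_distr_nonneg by (intro sum_mono2) auto
  finally show ?thesis .
qed

text \<open>Importance weighting cancels for each single draw \<open>i\<close>: the observation
  probability of an element is its weight in the \<open>w\<close>-average and also the denominator
  of its estimate. Passing from \<open>w\<close> to \<open>p\<close> then costs the factor of
  \<open>freezing_distr_le\<close>.\<close>

lemma expected_estimated_loss:
  assumes i: "i \<in> F" "freezing_distr E F \<gamma> p i \<noteq> 0" and l: "\<And>e. e \<in> E \<Longrightarrow> 0 \<le> l e"
  defines "w \<equiv> freezing_distr E F \<gamma> p"
  shows "(1 - real (card E) * \<gamma>) * strategy_loss l i
    \<le> (\<Sum>j\<in>F. p j * strategy_loss (estimated_loss F w l i) j)"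
proof -
  let ?x = "estimated_loss F w l i"
  have iE: "i \<subseteq> E"
    using i F_sub by auto
  have W: "0 < observation_prob F w e" if "e \<in> i" for e
    using observation_prob_ge[OF i that] \<gamma>_pos by (simp add: w_def)
  have x_nonneg: "0 \<le> ?x e" for e
    using W[of e] l[of e] iE by (auto simp: estimated_loss_def)
  \<comment> \<open>The estimates vanish off \<open>i\<close>, so the sum may run over all of
    \<open>E\<close>, which allows swapping it with the sum over strategies.\<close>
  have "strategy_loss l i = (\<Sum>e\<in>E. observation_prob F w e * ?x e)"
    unfolding strategy_loss_def
    using W iE finite_E by (intro sum.mono_neutral_cong_left) (force simp: estimated_loss_def)+
  also have "\<dots> = (\<Sum>e\<in>E. \<Sum>j\<in>F. if e \<in> j then w j * ?x e else 0)"
    unfolding observation_prob_def sum_distrib_right using finite_F by (simp add: sum.inter_filter)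
  also have "\<dots> = (\<Sum>j\<in>F. \<Sum>e\<in>E. if e \<in> j then w j * ?x e else 0)"
    by (rule sum.swap)
  also have "\<dots> = (\<Sum>j\<in>F. w j * strategy_loss ?x j)"
  proof (intro sum.cong refl)
    fix j assume "j \<in> F"
    then have "{e \<in> E. e \<in> j} = j"
      using F_sub by auto
    then show "(\<Sum>e\<in>E. if e \<in> j then w j * ?x e else 0) = w j * strategy_loss ?x j"
      using finite_E by (simp add: strategy_loss_def sum_distrib_left flip: sum.inter_filter)
  qed
  finally have "(1 - real (card E) * \<gamma>) * strategy_loss l i
    = (\<Sum>j\<in>F. ((1 - real (card E) * \<gamma>) * w j) * strategy_loss ?x j)"
    by (simp add: sum_distrib_left mult.assoc)
  also have "\<dots> \<le> (\<Sum>j\<in>F. p j * strategy_loss ?x j)"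
    using freezing_distr_le x_nonneg unfolding w_def strategy_loss_def
    by (intro sum_mono mult_right_mono sum_nonneg) auto
  finally show ?thesis .
qed

end

subsection \<open>Pathwise regret\<close>

text \<open>This puts the recursive history into the form \<open>map x [1..<t]\<close> that
  \<open>expected_approx_regret\<close> feeds to the full information algorithm.\<close>

lemma sbf_history_eq_map:
  "sbf_history E F A \<epsilon> l i n =
    map (\<lambda>t. estimated_loss F (sbf_distr E F A \<epsilon> l i t) (l t) (i t)) [1..<Suc n]"
  by (induction n) (simp_all add: Let_def sbf_distr_def)

lemma estimated_loss_in_loss_vectors:
  assumes "i \<subseteq> E" "\<And>e. e \<in> E \<Longrightarrow> 0 \<le> l e" "\<And>j. j \<in> F \<Longrightarrow> 0 \<le> w j"
  shows "estimated_loss F w l i \<in> loss_vectors E"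
  using assms by (auto simp: loss_vectors_def estimated_loss_def observation_prob_def intro!: divide_nonneg_nonneg sum_nonneg)

text \<open>Losses and draws are fixed sequences here. The full information guarantee holds for
  every loss sequence, so it applies to the realised estimates even though they depend on the draws.
  One factor \<open>1 - \<epsilon>\<close> comes from the approximate regret, the other from
  freezing.\<close>

lemma freezing_algorithm_pathwise_regret:
  fixes E :: "'e set"
  assumes eps: "0 < \<epsilon>" "\<epsilon> < 1"
    and fin: "finite E" "E \<noteq> {}" and F: "F \<subseteq> Pow E" "f \<in> F"
    and m: "\<And>f. f \<in> F \<Longrightarrow> card f \<le> m" and m_pos: "0 < m"
    and regret_bound:
      "\<And>L x f. L > 0 \<Longrightarrow>
         (\<And>t. t \<in> {1..T} \<Longrightarrow> x t \<in> loss_vectors E) \<Longrightarrow>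
         (\<And>t i. t \<in> {1..T} \<Longrightarrow> i \<in> F \<Longrightarrow> strategy_loss (x t) i \<le> L) \<Longrightarrow>
         f \<in> F \<Longrightarrow>
         expected_approx_regret F A \<epsilon> T x f \<le> L * B"
    and l: "\<And>t e. t \<in> {1..T} \<Longrightarrow> e \<in> E \<Longrightarrow> l t e \<in> {0..1}"
    and i: "\<And>t. t \<in> {1..T} \<Longrightarrow> i t \<in> F"
    and drawn: "\<And>t. t \<in> {1..T} \<Longrightarrow> sbf_distr E F A \<epsilon> l i t (i t) \<noteq> 0"
  defines "x \<equiv> \<lambda>t. estimated_loss F (sbf_distr E F A \<epsilon> l i t) (l t) (i t)"
  shows "\<And>t e. t \<in> {1..T} \<Longrightarrow> e \<in> i t \<Longrightarrow>
      \<epsilon> / real (card E) \<le> observation_prob F (sbf_distr E F A \<epsilon> l i t) e"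
    and "(1 - \<epsilon>)\<^sup>2 * (\<Sum>t=1..T. strategy_loss (l t) (i t))
    \<le> (\<Sum>t=1..T. strategy_loss (x t) f) + real m * real (card E) / \<epsilon> * B"
proof -
  define \<gamma> where "\<gamma> = \<epsilon> / real (card E)"
  have card: "0 < card E"
    using fin by (simp add: card_gt_0_iff)
  have \<gamma>: "0 < \<gamma>" "real (card E) * \<gamma> = \<epsilon>"
    using eps card by (auto simp: \<gamma>_def)
  define p where "p t = pmf (A (map x [1..<t]))" for t
  have p_nonneg: "0 \<le> p t j" for t j
    by (simp add: p_def)
  \<comment> \<open>The definition is unfolded at round \<open>t\<close> only, so that the
    occurrences of \<open>sbf_distr\<close> inside the history stay folded and match
    \<open>x\<close>.\<close>
  have w: "sbf_distr E F A \<epsilon> l i t = freezing_distr E F \<gamma> (p t)" if "t \<ge> 1" for t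
    using that
    by (simp add: sbf_distr_def[of _ _ _ _ _ _ t] sbf_distr_from_def sbf_history_eq_map \<gamma>_def x_def p_def)
  have x_vec: "x t \<in> loss_vectors E" if t: "t \<in> {1..T}" for t
    unfolding x_def
  proof (rule estimated_loss_in_loss_vectors)
    show "0 \<le> sbf_distr E F A \<epsilon> l i t j" for j
      using freezing_distr_nonneg[OF fin(1) F(1) p_nonneg \<gamma>(1)] t eps by (simp add: w \<gamma>(2))
  qed (use i[OF t] l[OF t] F in auto)
  have W: "\<gamma> \<le> observation_prob F (sbf_distr E F A \<epsilon> l i t) e"
    if t: "t \<in> {1..T}" "e \<in> i t" for t e
    using observation_prob_ge[OF fin(1) F(1) p_nonneg \<gamma>(1) _ i[OF t(1)] _ t(2)]
      drawn[OF t(1)] t eps by (simp add: w \<gamma>(2))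
  then show "\<And>t e. t \<in> {1..T} \<Longrightarrow> e \<in> i t \<Longrightarrow>
      \<epsilon> / real (card E) \<le> observation_prob F (sbf_distr E F A \<epsilon> l i t) e"
    by (simp add: \<gamma>_def)
  have x_le: "x t e \<le> 1 / \<gamma>" if t: "t \<in> {1..T}" for t e
  proof (cases "e \<in> i t")
    case True
    then have "e \<in> E"
      using i[OF t] F by auto
    then have "l t e / observation_prob F (sbf_distr E F A \<epsilon> l i t) e \<le> 1 / \<gamma>"
      using W[OF t True] l[OF t] \<gamma>(1) by (intro frac_le) auto
    then show ?thesis
      using True by (simp add: x_def estimated_loss_def)
  qed (use \<gamma>(1) in \<open>simp add: x_def estimated_loss_def\<close>)
  \<comment> \<open>The choice is \<open>L = m / \<gamma>\<close>: a strategy has at most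
    \<open>m\<close> elements, each with estimate at most \<open>1 / \<gamma>\<close>. Positivity of
    \<open>m\<close> makes \<open>L\<close> admissible.\<close>
  have "expected_approx_regret F A \<epsilon> T x f \<le> (real m * (1 / \<gamma>)) * B"
  proof (rule regret_bound)
    fix t j assume t: "t \<in> {1..T}" "j \<in> F"
    have "strategy_loss (x t) j \<le> real (card j) * (1 / \<gamma>)"
      unfolding strategy_loss_def using x_le[OF t(1)] by (intro sum_bounded_above) auto
    also have "\<dots> \<le> real m * (1 / \<gamma>)"
      using m[OF t(2)] \<gamma>(1) by (intro mult_right_mono) auto
    finally show "strategy_loss (x t) j \<le> real m * (1 / \<gamma>)" .
  qed (use F m_pos \<gamma>(1) x_vec in auto)
  moreover have "(1 - \<epsilon>) * ((1 - \<epsilon>) * (\<Sum>t=1..T. strategy_loss (l t) (i t)))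
    \<le> (1 - \<epsilon>) * (\<Sum>t=1..T. \<Sum>j\<in>F. p t j * strategy_loss (x t) j)"
  proof (intro mult_left_mono)
    have "(1 - \<epsilon>) * strategy_loss (l t) (i t) \<le> (\<Sum>j\<in>F. p t j * strategy_loss (x t) j)"
      if t: "t \<in> {1..T}" for t
      using expected_estimated_loss[OF fin(1) F(1) p_nonneg \<gamma>(1) _ i[OF t], where l = "l t"]
        drawn[OF t] l[OF t] t eps by (simp add: w \<gamma>(2) x_def)
    then show "(1 - \<epsilon>) * (\<Sum>t=1..T. strategy_loss (l t) (i t))
      \<le> (\<Sum>t=1..T. \<Sum>j\<in>F. p t j * strategy_loss (x t) j)"
      unfolding sum_distrib_left by (intro sum_mono)
  qed (use eps in simp)
  ultimately show "(1 - \<epsilon>)\<^sup>2 * (\<Sum>t=1..T. strategy_loss (l t) (i t))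
    \<le> (\<Sum>t=1..T. strategy_loss (x t) f) + real m * real (card E) / \<epsilon> * B"
    by (simp add: expected_approx_regret_def p_def \<gamma>_def power2_eq_square mult.assoc)
qed

subsection \<open>Concentration of adapted sums\<close>

lemma exp_mult_le_affine:
  fixes c x :: real
  assumes "0 \<le> x" "x \<le> 1"
  shows "exp (c * x) \<le> 1 + (exp c - 1) * x"
  using convex_onD[OF exp_convex, of x 0 c] assms by (simp add: algebra_simps)

text \<open>
  By convexity of \<open>exp\<close>, the conditional exponential moment of a \<open>[0, 1]\<close>-valued increment is at most that
  of a Bernoulli variable of the same conditional mean, so the exponential below is a supermartingale.
\<close>

lemma (in prob_space) adapted_exp_moment_le_1:
  fixes X \<mu> :: "nat \<Rightarrow> 'a \<Rightarrow> real"
  assumes filt: "filtration (space M) G" and sub: "\<And>t. subalgebra M (G t)"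
    and X_meas: "\<And>t. t \<in> {1..T} \<Longrightarrow> X t \<in> borel_measurable (G (Suc t))"
    and \<mu>_meas: "\<And>t. t \<in> {1..T} \<Longrightarrow> \<mu> t \<in> borel_measurable (G t)"
    and X_range: "\<And>t \<omega>. t \<in> {1..T} \<Longrightarrow> \<omega> \<in> space M \<Longrightarrow> X t \<omega> \<in> {0..1}"
    and \<mu>_nonneg: "\<And>t \<omega>. t \<in> {1..T} \<Longrightarrow> \<omega> \<in> space M \<Longrightarrow> 0 \<le> \<mu> t \<omega>"
    and cond: "\<And>t. t \<in> {1..T} \<Longrightarrow> AE \<omega> in M. real_cond_exp M (G t) (X t) \<omega> \<le> \<mu> t \<omega>"
    and c: "0 \<le> c"
  defines "Z \<equiv> \<lambda>n \<omega>. exp (\<Sum>t=1..n. c * X t \<omega> - (exp c - 1) * \<mu> t \<omega>)"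
  assumes "n \<le> T"
  shows "integrable M (Z n)" "expectation (Z n) \<le> 1"
proof -
  have mono_meas: "f \<in> borel_measurable (G t)" if "s \<le> t" "f \<in> borel_measurable (G s)"
    for f :: "'a \<Rightarrow> real" and s t
    using filtration.sets_F_mono[OF filt that(1)] filtration.space_F[OF filt]
    by (intro measurable_from_subalg[OF _ that(2)]) (simp add: subalgebra_def)
  \<comment> \<open>\<open>Z n\<close> involves \<open>X n\<close>, so it is known only from
    \<open>G (Suc n)\<close> on; this is exactly the conditioning algebra of the next round.\<close>
  have Z_meas: "Z n \<in> borel_measurable (G (Suc n))" if "n \<le> T" for n
    unfolding Z_def using that
    by (intro measurable_compose[OF _ borel_measurable_exp] borel_measurable_sum borel_measurable_diff
        borel_measurable_times borel_measurable_const mono_meas[OF _ X_meas] mono_meas[OF _ \<mu>_meas]) auto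
  \<comment> \<open>This crude bound serves integrability only.\<close>
  have Z_le: "Z n \<omega> \<le> exp (real n * c)" if "n \<le> T" "\<omega> \<in> space M" for n \<omega>
  proof -
    have "c * X t \<omega> - (exp c - 1) * \<mu> t \<omega> \<le> c" if t: "t \<in> {1..n}" for t
    proof -
      have t: "t \<in> {1..T}"
        using t \<open>n \<le> T\<close> by auto
      have "c * X t \<omega> \<le> c" "0 \<le> (exp c - 1) * \<mu> t \<omega>"
        using X_range[OF t \<open>\<omega> \<in> space M\<close>] \<mu>_nonneg[OF t \<open>\<omega> \<in> space M\<close>] c
        by (auto intro: mult_left_le)
      then show ?thesis
        by simp
    qed
    then have "(\<Sum>t=1..n. c * X t \<omega> - (exp c - 1) * \<mu> t \<omega>) \<le> real (card {1..n}) * c"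
      by (rule sum_bounded_above)
    then show ?thesis
      by (simp add: Z_def)
  qed
  have Z_int: "integrable M (Z n)" if "n \<le> T" for n
  proof (rule integrable_const_bound)
    show "AE \<omega> in M. norm (Z n \<omega>) \<le> exp (real n * c)"
      using Z_le[OF that] by (intro AE_I2) (auto simp: Z_def)
    show "Z n \<in> borel_measurable M"
      using measurable_from_subalg[OF sub Z_meas[OF that]] .
  qed
  then show "integrable M (Z n)"
    using \<open>n \<le> T\<close> .
  show "expectation (Z n) \<le> 1"
    using \<open>n \<le> T\<close>
  proof (induction n)
    case 0
    then show ?case
      by (simp add: Z_def prob_space)
  next
    case (Suc n)
    define t where "t = Suc n"
    have t: "t \<in> {1..T}"
      using Suc.prems by (auto simp: t_def)
    interpret finite_measure_subalgebra M "G t"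
      by unfold_locales (rule sub)
    define a where "a = exp c - 1"
    have a: "0 \<le> a"
      using c by (simp add: a_def)
    \<comment> \<open>\<open>Y\<close> is the part of \<open>Z t\<close> already known in
      \<open>G t\<close>: \<open>Z t\<close> equals \<open>Y * exp (c * X t)\<close>. After the
      affine bound on the exponential, \<open>X t\<close> can therefore be replaced by its
      conditional expectation under the integral.\<close>
    define Y where "Y \<omega> = Z n \<omega> * exp (- a * \<mu> t \<omega>)" for \<omega>
    have Y_meas: "Y \<in> borel_measurable (G t)"
      unfolding Y_def using Z_meas[of n] \<mu>_meas[OF t] Suc.prems by (auto simp: t_def)
    have Y_meas_M: "Y \<in> borel_measurable M"
      using measurable_from_subalg[OF sub Y_meas] .
    have Y_nonneg: "0 \<le> Y \<omega>" for \<omega>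
      by (simp add: Y_def Z_def)
    have Y_le_Z: "Y \<omega> \<le> Z n \<omega>" if "\<omega> \<in> space M" for \<omega>
      using \<mu>_nonneg[OF t that] a by (auto simp: Y_def Z_def mult_nonneg_nonneg)
    have Y_int: "integrable M Y"
      using Z_int[of n] Suc.prems Y_meas_M
      by (rule_tac Bochner_Integration.integrable_bound) (use Y_nonneg Y_le_Z in \<open>auto simp: Z_def intro!: AE_I2\<close>)
    have X_M: "X t \<in> borel_measurable M"
      using measurable_from_subalg[OF sub X_meas[OF t]] .
    have YX_int: "integrable M (\<lambda>\<omega>. Y \<omega> * X t \<omega>)"
      using Y_int
    proof (rule Bochner_Integration.integrable_bound)
      show "AE \<omega> in M. norm (Y \<omega> * X t \<omega>) \<le> norm (Y \<omega>)"
        using X_range[OF t] Y_nonneg by (intro AE_I2) (auto simp: abs_mult intro: mult_left_le)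
    qed (use Y_meas_M X_M in measurable)
    note YE = real_cond_exp_intg[OF YX_int Y_meas X_M]
    have "expectation (Z t) \<le> expectation (\<lambda>\<omega>. Y \<omega> + a * (Y \<omega> * X t \<omega>))"
    proof (rule integral_mono)
      fix \<omega> assume \<omega>: "\<omega> \<in> space M"
      have "Z t \<omega> = Y \<omega> * exp (c * X t \<omega>)"
        by (simp add: Z_def Y_def t_def a_def algebra_simps flip: exp_add)
      also have "\<dots> \<le> Y \<omega> * (1 + a * X t \<omega>)"
        using X_range[OF t \<omega>] Y_nonneg unfolding a_def
        by (intro mult_left_mono exp_mult_le_affine) auto
      finally show "Z t \<omega> \<le> Y \<omega> + a * (Y \<omega> * X t \<omega>)"
        by (simp add: algebra_simps)
    qed (use Y_int YX_int Z_int[of t] t in auto)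
    also have "\<dots> = expectation (\<lambda>\<omega>. Y \<omega> + a * (Y \<omega> * real_cond_exp M (G t) (X t) \<omega>))"
      using Y_int YX_int YE by simp
    also have "\<dots> \<le> expectation (Z n)"
    proof (rule integral_mono_AE)
      show "AE \<omega> in M. Y \<omega> + a * (Y \<omega> * real_cond_exp M (G t) (X t) \<omega>) \<le> Z n \<omega>"
        using cond[OF t]
      proof eventually_elim
        case (elim \<omega>)
        have "Y \<omega> + a * (Y \<omega> * real_cond_exp M (G t) (X t) \<omega>) \<le> Y \<omega> + a * (Y \<omega> * \<mu> t \<omega>)"
          using elim a Y_nonneg by (intro add_left_mono mult_left_mono) auto
        also have "\<dots> = Y \<omega> * (1 + a * \<mu> t \<omega>)"
          by (simp add: algebra_simps)
        \<comment> \<open>By \<open>1 + y \<le> exp y\<close>, the conditional growth is absorbed by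
          the compensating factor built into \<open>Y\<close>, which restores
          \<open>Z n\<close>.\<close>
        also have "\<dots> \<le> Y \<omega> * exp (a * \<mu> t \<omega>)"
          using Y_nonneg exp_ge_add_one_self by (intro mult_left_mono) auto
        also have "\<dots> = Z n \<omega>"
          by (simp add: Y_def mult.assoc flip: exp_add)
        finally show ?case .
      qed
    qed (use Y_int YE Z_int[of n] Suc.prems in auto)
    finally show ?case
      using Suc by (simp add: t_def)
  qed
qed

text \<open>Markov's inequality for the exponential at time \<open>T\<close>. The parameter
  \<open>c\<close> stays fixed, which gives a multiplicative comparison with an additive error
  \<open>ln b\<close> independent of \<open>T\<close>.\<close>

lemma (in prob_space) adapted_sum_concentration:
  fixes X \<mu> :: "nat \<Rightarrow> 'a \<Rightarrow> real"
  assumes filt: "filtration (space M) G" and sub: "\<And>t. subalgebra M (G t)"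
    and X_meas: "\<And>t. t \<in> {1..T} \<Longrightarrow> X t \<in> borel_measurable (G (Suc t))"
    and \<mu>_meas: "\<And>t. t \<in> {1..T} \<Longrightarrow> \<mu> t \<in> borel_measurable (G t)"
    and X_range: "\<And>t \<omega>. t \<in> {1..T} \<Longrightarrow> \<omega> \<in> space M \<Longrightarrow> X t \<omega> \<in> {0..1}"
    and \<mu>_nonneg: "\<And>t \<omega>. t \<in> {1..T} \<Longrightarrow> \<omega> \<in> space M \<Longrightarrow> 0 \<le> \<mu> t \<omega>"
    and cond: "\<And>t. t \<in> {1..T} \<Longrightarrow> AE \<omega> in M. real_cond_exp M (G t) (X t) \<omega> \<le> \<mu> t \<omega>"
    and c: "0 \<le> c" and b: "0 < b"
  shows "\<P>(\<omega> in M. c * (\<Sum>t=1..T. X t \<omega>) \<ge> (exp c - 1) * (\<Sum>t=1..T. \<mu> t \<omega>) + ln b) \<le> 1 / b"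
proof -
  let ?Z = "\<lambda>\<omega>. exp (\<Sum>t=1..T. c * X t \<omega> - (exp c - 1) * \<mu> t \<omega>)"
  note Z = adapted_exp_moment_le_1[OF filt sub X_meas \<mu>_meas X_range \<mu>_nonneg cond c order_refl]
  have "(c * (\<Sum>t=1..T. X t \<omega>) \<ge> (exp c - 1) * (\<Sum>t=1..T. \<mu> t \<omega>) + ln b) \<longleftrightarrow> b \<le> ?Z \<omega>" for \<omega>
    using b exp_le_cancel_iff[of "ln b" "\<Sum>t=1..T. c * X t \<omega> - (exp c - 1) * \<mu> t \<omega>"]
    by (auto simp: sum_subtractf sum_distrib_left)
  then have "\<P>(\<omega> in M. c * (\<Sum>t=1..T. X t \<omega>) \<ge> (exp c - 1) * (\<Sum>t=1..T. \<mu> t \<omega>) + ln b)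
    = \<P>(\<omega> in M. b \<le> ?Z \<omega>)"
    by simp
  also have "\<dots> \<le> expectation ?Z / b"
    using Z(1) b by (intro integral_Markov_inequality_measure[of _ _ "{}"]) auto
  also have "\<dots> \<le> 1 / b"
    using Z(2) b by (intro divide_right_mono) auto
  finally show ?thesis .
qed

subsection \<open>Estimates in the semi-bandit protocol\<close>

context semi_bandit_protocol
begin

lemma draw_in_strategies: "t \<in> {1..T} \<Longrightarrow> \<omega> \<in> space M \<Longrightarrow> I t \<omega> \<in> F"
  using measurable_space[OF draw_measurable, of t \<omega>] space_F[of "Suc t"] by simp

lemma draw_measurable_M: "t \<in> {1..T} \<Longrightarrow> I t \<in> M \<rightarrow>\<^sub>M count_space F"
  using measurable_from_subalg[OF subalg draw_measurable] .

lemma draw_sets: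
  assumes "t \<in> {1..T}"
  shows "{\<omega> \<in> space M. I t \<omega> \<in> S} \<in> sets (G (Suc t))"
proof -
  have "I t -` (S \<inter> F) \<inter> space (G (Suc t)) \<in> sets (G (Suc t))"
    by (rule measurable_sets[OF draw_measurable[OF assms]]) simp
  also have "I t -` (S \<inter> F) \<inter> space (G (Suc t)) = {\<omega> \<in> space M. I t \<omega> \<in> S}"
    using draw_in_strategies[OF assms] by (auto simp: space_F)
  finally show ?thesis .
qed

lemma observation_prob_measurable:
  "t \<in> {1..T} \<Longrightarrow> (\<lambda>\<omega>. observation_prob F (w t \<omega>) e) \<in> borel_measurable (G t)"
  unfolding observation_prob_def by (intro borel_measurable_sum distr_measurable) auto

text \<open>The event \<open>w t \<omega> f = 0\<close> lies in \<open>G t\<close>, so integrating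
  the conditional law over it shows that drawing \<open>f\<close> there has probability zero.
  Finiteness of \<open>F\<close> combines the null sets.\<close>

lemma AE_draw_prob_nonzero:
  assumes "finite F" and t: "t \<in> {1..T}"
  shows "AE \<omega> in M. w t \<omega> (I t \<omega>) \<noteq> 0"
proof -
  interpret S: finite_measure_subalgebra M "G t"
    by unfold_locales (rule subalg)
  have "AE \<omega> in M. I t \<omega> = f \<longrightarrow> w t \<omega> f \<noteq> 0" if f: "f \<in> F" for f
  proof -
    let ?D = "{\<omega> \<in> space M. I t \<omega> = f}" and ?Z = "{\<omega> \<in> space M. w t \<omega> f = 0}"
    have [measurable]: "(\<lambda>\<omega>. w t \<omega> f) \<in> borel_measurable (G t)"
      using distr_measurable[OF t f] .
    have "{\<omega> \<in> space (G t). w t \<omega> f = 0} \<in> sets (G t)"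
      by measurable
    then have Z: "?Z \<in> sets (G t)"
      by (simp add: space_F)
    have D: "?D \<in> sets M"
      using draw_sets[OF t, of "{f}"] subalg[of "Suc t"] by (auto simp: subalgebra_def)
    have ZM: "?Z \<in> sets M"
      using Z subalg[of t] by (auto simp: subalgebra_def)
    have int: "integrable M (\<lambda>\<omega>. indicator ?Z \<omega> * (indicator ?D \<omega> :: real))"
      using D ZM by (intro integrable_const_bound[where B = 1]) (auto simp: indicator_def)
    have "expectation (\<lambda>\<omega>. indicator ?Z \<omega> * indicator ?D \<omega>)
      = expectation (\<lambda>\<omega>. indicator ?Z \<omega> * real_cond_exp M (G t) (indicator ?D) \<omega>)"
      using D Z by (intro S.real_cond_exp_intg(2)[OF int, symmetric]) auto
    also have "\<dots> = expectation (\<lambda>\<omega>. 0)"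
    proof (rule integral_cong_AE)
      show "AE \<omega> in M. indicator ?Z \<omega> * real_cond_exp M (G t) (indicator ?D) \<omega> = 0"
        using draw_law[OF t f] by eventually_elim (auto simp: indicator_def)
      show "(\<lambda>\<omega>. indicator ?Z \<omega> * real_cond_exp M (G t) (indicator ?D) \<omega>) \<in> borel_measurable M"
        using ZM by (intro borel_measurable_times borel_measurable_cond_exp2 borel_measurable_indicator)
    qed simp
    finally have "AE \<omega> in M. indicator ?Z \<omega> * (indicator ?D \<omega> :: real) = 0"
      using integral_nonneg_eq_0_iff_AE[OF int] by simp
    then show ?thesis
      using AE_space by eventually_elim (auto simp: indicator_def split: if_splits)
  qed
  then have "AE \<omega> in M. \<forall>f\<in>F. I t \<omega> = f \<longrightarrow> w t \<omega> f \<noteq> 0"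
    by (rule AE_finite_allI[OF assms(1)])
  then show ?thesis
    using AE_space by eventually_elim (use draw_in_strategies[OF t] in auto)
qed

text \<open>
  The estimate of the loss of \<open>e\<close>, scaled by \<open>\<gamma>\<close> and cut off where \<open>e\<close> is observed with probability
  below \<open>\<gamma>\<close>. The algorithm almost surely never meets the cut-off, which is there to bound the estimate
  by \<open>1\<close> on the whole sample space.
\<close>

definition scaled_estimate :: "real \<Rightarrow> 'e \<Rightarrow> nat \<Rightarrow> 'm \<Rightarrow> real" where
  "scaled_estimate \<gamma> e t \<omega> =
     (if \<gamma> \<le> observation_prob F (w t \<omega>) e then \<gamma> * l t \<omega> e / observation_prob F (w t \<omega>) e else 0)
       * indicator {\<omega> \<in> space M. e \<in> I t \<omega>} \<omega>"

text \<open>The factor in front of the indicator is known in \<open>G t\<close>. Splitting the event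
  that \<open>e\<close> is observed according to the drawn strategy gives it conditional probability
  \<open>observation_prob F (w t \<omega>) e\<close>, which cancels the denominator. The cut-off can
  only lower the result, hence an inequality.\<close>

lemma
  assumes t: "t \<in> {1..T}" and e: "e \<in> E" and "finite F" and \<gamma>: "0 < \<gamma>"
  shows scaled_estimate_measurable: "scaled_estimate \<gamma> e t \<in> borel_measurable (G (Suc t))"
    and scaled_estimate_range: "\<omega> \<in> space M \<Longrightarrow> scaled_estimate \<gamma> e t \<omega> \<in> {0..1}"
    and scaled_estimate_cond_exp:
      "AE \<omega> in M. real_cond_exp M (G t) (scaled_estimate \<gamma> e t) \<omega> \<le> \<gamma> * l t \<omega> e"
proof -
  interpret S: finite_measure_subalgebra M "G t"
    by unfold_locales (rule subalg)
  let ?W = "\<lambda>\<omega>. observation_prob F (w t \<omega>) e"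
  define h where "h \<omega> = (if \<gamma> \<le> ?W \<omega> then \<gamma> * l t \<omega> e / ?W \<omega> else 0)" for \<omega>
  have est: "scaled_estimate \<gamma> e t = (\<lambda>\<omega>. h \<omega> * indicator {\<omega> \<in> space M. e \<in> I t \<omega>} \<omega>)"
    by (auto simp: scaled_estimate_def h_def fun_eq_iff)
  have h_meas: "h \<in> borel_measurable (G t)"
    unfolding h_def using observation_prob_measurable[OF t, of e] loss_measurable[OF t e] by measurable
  have subG: "subalgebra (G (Suc t)) (G t)"
    using sets_F_mono[of t "Suc t"] by (simp add: subalgebra_def space_F)
  have "{\<omega> \<in> space M. e \<in> I t \<omega>} \<in> sets (G (Suc t))"
    using draw_sets[OF t, of "{f. e \<in> f}"] by simp
  then show "scaled_estimate \<gamma> e t \<in> borel_measurable (G (Suc t))"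
    unfolding est by (intro borel_measurable_times borel_measurable_indicator
        measurable_from_subalg[OF subG h_meas])
  have h_range: "h \<omega> \<in> {0..1}" if "\<omega> \<in> space M" for \<omega>
  proof -
    have "\<gamma> * l t \<omega> e \<le> \<gamma>" "0 \<le> \<gamma> * l t \<omega> e"
      using loss_range[OF t e that] \<gamma> by (auto intro: mult_left_le)
    moreover have "a / W \<in> {0..1}" if "a \<le> \<gamma>" "0 \<le> a" "\<gamma> \<le> W" for a W :: real
      using that \<gamma> by (auto simp: divide_le_eq_1)
    ultimately show ?thesis
      unfolding h_def by simp
  qed
  then show "\<omega> \<in> space M \<Longrightarrow> scaled_estimate \<gamma> e t \<omega> \<in> {0..1}"
    by (auto simp: est indicator_def)
  define J where "J = {f \<in> F. e \<in> f}"
  let ?D = "\<lambda>f. {\<omega> \<in> space M. I t \<omega> = f}"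
  have D: "?D f \<in> sets M" for f
    using draw_sets[OF t, of "{f}"] subalg[of "Suc t"] by (auto simp: subalgebra_def)
  have est_sum: "scaled_estimate \<gamma> e t = (\<lambda>\<omega>. \<Sum>f\<in>J. h \<omega> * indicator (?D f) \<omega>)"
  proof
    fix \<omega>
    have "indicator {\<omega> \<in> space M. e \<in> I t \<omega>} \<omega> = (\<Sum>f\<in>J. indicator (?D f) \<omega> :: real)"
    proof (cases "\<omega> \<in> space M")
      case True
      then have "(\<Sum>f\<in>J. indicator (?D f) \<omega> :: real) = (\<Sum>f\<in>J. if I t \<omega> = f then 1 else 0)"
        by (intro sum.cong) (auto simp: indicator_def)
      also have "\<dots> = indicator {\<omega> \<in> space M. e \<in> I t \<omega>} \<omega>"
        using assms(3) draw_in_strategies[OF t True] True by (simp add: J_def indicator_def)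
      finally show ?thesis
        by simp
    qed (simp add: indicator_def)
    then show "scaled_estimate \<gamma> e t \<omega> = (\<Sum>f\<in>J. h \<omega> * indicator (?D f) \<omega>)"
      by (simp add: est sum_distrib_left)
  qed
  have int: "integrable M (\<lambda>\<omega>. h \<omega> * indicator (?D f) \<omega>)" for f
  proof (rule integrable_const_bound)
    show "AE \<omega> in M. norm (h \<omega> * indicator (?D f) \<omega>) \<le> 1"
      using h_range by (intro AE_I2) (auto simp: indicator_def)
    show "(\<lambda>\<omega>. h \<omega> * indicator (?D f) \<omega>) \<in> borel_measurable M"
      using D measurable_from_subalg[OF subalg h_meas] by measurable
  qed
  have "AE \<omega> in M. \<forall>f\<in>J. real_cond_exp M (G t) (\<lambda>\<omega>. h \<omega> * indicator (?D f) \<omega>) \<omega> = h \<omega> * w t \<omega> f"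
  proof (rule AE_finite_allI)
    fix f assume "f \<in> J"
    then have "f \<in> F"
      by (simp add: J_def)
    show "AE \<omega> in M. real_cond_exp M (G t) (\<lambda>\<omega>. h \<omega> * indicator (?D f) \<omega>) \<omega> = h \<omega> * w t \<omega> f"
      using S.real_cond_exp_mult[OF h_meas _ int, of f] draw_law[OF t \<open>f \<in> F\<close>] D
      by (auto elim: eventually_elim2)
  qed (use assms(3) in \<open>simp add: J_def\<close>)
  moreover have "AE \<omega> in M. real_cond_exp M (G t) (scaled_estimate \<gamma> e t) \<omega>
    = (\<Sum>f\<in>J. real_cond_exp M (G t) (\<lambda>\<omega>. h \<omega> * indicator (?D f) \<omega>) \<omega>)"
    unfolding est_sum by (rule S.real_cond_exp_sum[OF int])
  ultimately show "AE \<omega> in M. real_cond_exp M (G t) (scaled_estimate \<gamma> e t) \<omega> \<le> \<gamma> * l t \<omega> e"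
    using AE_space
  proof eventually_elim
    case (elim \<omega>)
    then have "real_cond_exp M (G t) (scaled_estimate \<gamma> e t) \<omega> = h \<omega> * ?W \<omega>"
      by (simp add: J_def observation_prob_def sum_distrib_left)
    then show ?case
      using \<gamma> loss_range[OF t e elim(3)] by (auto simp: h_def)
  qed
qed

lemma estimate_concentration:
  assumes e: "e \<in> E" and F: "finite F" and \<gamma>: "0 < \<gamma>" and c: "0 \<le> c" and b: "0 < b"
  shows "\<P>(\<omega> in M. c * (\<Sum>t=1..T. scaled_estimate \<gamma> e t \<omega>)
      \<ge> (exp c - 1) * (\<Sum>t=1..T. \<gamma> * l t \<omega> e) + ln b) \<le> 1 / b"
proof (rule adapted_sum_concentration[OF filtration_axioms subalg _ _ _ _ _ c b])
  fix t assume t: "t \<in> {1..T}"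
  note est = scaled_estimate_measurable[OF t e F \<gamma>] scaled_estimate_range[OF t e F \<gamma>]
    scaled_estimate_cond_exp[OF t e F \<gamma>]
  show "scaled_estimate \<gamma> e t \<in> borel_measurable (G (Suc t))"
    "AE \<omega> in M. real_cond_exp M (G t) (scaled_estimate \<gamma> e t) \<omega> \<le> \<gamma> * l t \<omega> e"
    using est by auto
  show "(\<lambda>\<omega>. \<gamma> * l t \<omega> e) \<in> borel_measurable (G t)"
    using loss_measurable[OF t e] by measurable
  fix \<omega> assume \<omega>: "\<omega> \<in> space M"
  show "scaled_estimate \<gamma> e t \<omega> \<in> {0..1}"
    using est \<omega> by auto
  show "0 \<le> \<gamma> * l t \<omega> e"
    using loss_range[OF t e \<omega>] \<gamma> by auto
qed

lemma strategy_loss_measurable: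
  assumes "t \<in> {1..T}" "F \<subseteq> Pow E" "f \<in> F"
  shows "(\<lambda>\<omega>. strategy_loss (l t \<omega>) f) \<in> borel_measurable M"
  unfolding strategy_loss_def
proof (rule borel_measurable_sum)
  fix e assume "e \<in> f"
  then have "e \<in> E"
    using assms by auto
  then show "(\<lambda>\<omega>. l t \<omega> e) \<in> borel_measurable M"
    by (rule measurable_from_subalg[OF subalg loss_measurable[OF assms(1)]])
qed

lemma incurred_loss_measurable:
  assumes "t \<in> {1..T}" "F \<subseteq> Pow E" "finite F"
  shows "(\<lambda>\<omega>. strategy_loss (l t \<omega>) (I t \<omega>)) \<in> borel_measurable M"
proof (rule measurable_compose_countable'[where g = "I t" and I = F])
  show "(\<lambda>\<omega>. strategy_loss (l t \<omega>) f) \<in> borel_measurable M" if "f \<in> F" for f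
    using strategy_loss_measurable[OF assms(1,2) that] .
  show "I t \<in> M \<rightarrow>\<^sub>M count_space F"
    using draw_measurable_M[OF assms(1)] .
  show "countable F"
    using assms(3) by (rule countable_finite)
qed

end

subsection \<open>The regret bound\<close>

text \<open>The estimate is multiplied by \<open>ln (1 + x)\<close>, so that quantity is bounded
  below by \<open>x / (1 + x)\<close> in front of \<open>S\<close> and above by \<open>x\<close> in
  front of \<open>K\<close>; the latter requires \<open>K\<close> to be nonnegative.\<close>

lemma approx_regret_arith:
  fixes x :: real
  assumes x: "0 < x" and S: "0 \<le> S" and K: "0 \<le> K"
    and algorithm: "(1 - x)\<^sup>2 * S \<le> Y + K"
    and estimates: "ln (1 + x) * Y \<le> x * L + R"
  shows "(1 - 3 * x) * S - L \<le> R / x + K"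
proof -
  let ?c = "ln (1 + x)"
  have c: "0 \<le> ?c" "?c \<le> x" "x \<le> ?c * (1 + x)"
  proof -
    show "0 \<le> ?c" "?c \<le> x"
      using x by (auto simp: ln_add_one_self_le_self)
    \<comment> \<open>The lower bound on \<open>ln (1 + x)\<close> is
      \<open>ln y \<le> y - 1\<close> at the reciprocal of \<open>1 + x\<close>.\<close>
    have "ln (1 / (1 + x)) \<le> 1 / (1 + x) - 1"
      using x by (intro ln_le_minus_one) simp
    then have "x / (1 + x) \<le> ?c"
      using x by (simp add: ln_div field_simps)
    then show "x \<le> ?c * (1 + x)"
      using x by (simp add: field_simps)
  qed
  \<comment> \<open>After division by \<open>x\<close>, the two sides differ by
    \<open>4 * x\<^sup>2\<close>.\<close>
  have "x * (1 - 3 * x) * (1 + x) \<le> x * (1 - x)\<^sup>2"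
    using x by (simp add: power2_eq_square algebra_simps)
  also have "\<dots> \<le> (?c * (1 + x)) * (1 - x)\<^sup>2"
    using c by (intro mult_right_mono) auto
  finally have "x * (1 - 3 * x) \<le> ?c * (1 - x)\<^sup>2"
    using x by (simp add: mult.assoc mult.left_commute mult.commute[of "1 + x"])
  then have "x * (1 - 3 * x) * S \<le> ?c * ((1 - x)\<^sup>2 * S)"
    using S by (simp add: mult_right_mono flip: mult.assoc)
  also have "\<dots> \<le> ?c * (Y + K)"
    using algorithm c by (intro mult_left_mono)
  also have "\<dots> \<le> x * L + R + x * K"
    using estimates mult_right_mono[OF c(2) K] by (simp add: algebra_simps)
  finally have "x * ((1 - 3 * x) * S - L) \<le> x * (R / x + K)"
    using x by (simp add: algebra_simps)
  then show ?thesis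
    using x by simp
qed

theorem theorem5p1:
  fixes E :: "'e set" and F :: "'e set set"
    and A :: "'e full_info_alg"
    and B :: "real \<Rightarrow> nat \<Rightarrow> 'e set set \<Rightarrow> real"
    and M :: "'m measure" and G :: "nat \<Rightarrow> 'm measure"
    and l :: "nat \<Rightarrow> 'm \<Rightarrow> 'e \<Rightarrow> real" and I :: "nat \<Rightarrow> 'm \<Rightarrow> 'e set"
    and \<epsilon> \<delta> :: real and T m :: nat
  assumes eps: "0 < \<epsilon>" "\<epsilon> < 1"
    and elements: "finite E"
    and strategies: "F \<subseteq> Pow E" "F \<noteq> {}"
    and m: "m = Max (card ` F)"
    and algorithm: "full_info_algorithm E F A"
    and regret_bound:
      "\<And>L x f. L > 0 \<Longrightarrow>
         (\<And>t. t \<in> {1..T} \<Longrightarrow> x t \<in> loss_vectors E) \<Longrightarrow>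
         (\<And>t i. t \<in> {1..T} \<Longrightarrow> i \<in> F \<Longrightarrow> strategy_loss (x t) i \<le> L) \<Longrightarrow>
         f \<in> F \<Longrightarrow>
         expected_approx_regret F A (\<epsilon> / 3) T x f \<le> L * B \<epsilon> T F"
    and protocol:
      "semi_bandit_protocol M G E F T
         (\<lambda>t \<omega>. sbf_distr E F A (\<epsilon> / 3) (\<lambda>s. l s \<omega>) (\<lambda>s. I s \<omega>) t) l I"
    and delta: "\<delta> > 0"
  shows "\<P>(\<omega> in M. \<forall>f\<in>F.
           (1 - \<epsilon>) * (\<Sum>t=1..T. strategy_loss (l t \<omega>) (I t \<omega>))
             - (\<Sum>t=1..T. strategy_loss (l t \<omega>) f)
           \<le> 9 * real m * real (card E) * ln (real (card E) / \<delta>) / \<epsilon>\<^sup>2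
             + 3 * real m * real (card E) * B \<epsilon> T F / \<epsilon>)
         \<ge> 1 - \<delta>"
proof (cases "\<delta> < 1 \<and> 0 < m")
  \<comment> \<open>The degenerate cases: for \<delta> at least 1 the claimed probability is at most
    0, and for \<open>m = 0\<close> every strategy is empty, so all losses vanish. Otherwise
    \<open>ln b\<close> and the loss bound \<open>m / \<gamma>\<close> below are positive.\<close>
  case False
  interpret semi_bandit_protocol M G E F T
    "\<lambda>t \<omega>. sbf_distr E F A (\<epsilon> / 3) (\<lambda>s. l s \<omega>) (\<lambda>s. I s \<omega>) t" l I
    by (rule protocol)
  have finite_F: "finite F"
    using elements strategies finite_subset by auto
  from False consider "1 \<le> \<delta>" | "m = 0"
    by fastforce
  then show ?thesis
  proof cases
    case 1
    then show ?thesis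
      by (intro order_trans[OF _ measure_nonneg]) simp
  next
    case 2
    have empty: "f = {}" if "f \<in> F" for f
    proof -
      have "card f \<le> m"
        unfolding m using finite_F that by (intro Max_ge) auto
      then show ?thesis
        using 2 that strategies elements finite_subset[of f E] by auto
    qed
    have "strategy_loss (l t \<omega>) (I t \<omega>) = 0" if "t \<in> {1..T}" "\<omega> \<in> space M" for t \<omega>
      using empty[OF draw_in_strategies[OF that]] by (simp add: strategy_loss_def)
    then have "(\<Sum>t=1..T. strategy_loss (l t \<omega>) (I t \<omega>)) = 0" if "\<omega> \<in> space M" for \<omega>
      using that by (intro sum.neutral ballI)
    moreover have "(\<Sum>t=1..T. strategy_loss (l t \<omega>) f) = 0" if "f \<in> F" for f \<omega>
      using empty[OF that] by (simp add: strategy_loss_def)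
    ultimately have "{\<omega> \<in> space M. \<forall>f\<in>F.
           (1 - \<epsilon>) * (\<Sum>t=1..T. strategy_loss (l t \<omega>) (I t \<omega>))
             - (\<Sum>t=1..T. strategy_loss (l t \<omega>) f)
           \<le> 9 * real m * real (card E) * ln (real (card E) / \<delta>) / \<epsilon>\<^sup>2
             + 3 * real m * real (card E) * B \<epsilon> T F / \<epsilon>} = space M"
      using 2 by auto
    then show ?thesis
      using delta by (simp add: prob_space)
  qed
next
  case True
  let ?w = "\<lambda>t \<omega>. sbf_distr E F A (\<epsilon> / 3) (\<lambda>s. l s \<omega>) (\<lambda>s. I s \<omega>) t"
  interpret semi_bandit_protocol M G E F T ?w l I
    by (rule protocol)
  have finite_F: "finite F"
    using elements strategies finite_subset by auto
  have card_le: "card f \<le> m" if "f \<in> F" for f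
    unfolding m using finite_F that by (intro Max_ge) auto
  have "m \<in> card ` F"
    unfolding m using finite_F strategies by (intro Max_in) auto
  then obtain f0 where f0: "f0 \<in> F" "card f0 = m"
    by auto
  have E_nonempty: "E \<noteq> {}"
    using True f0 strategies by auto
  define d where "d = real (card E)"
  have d: "1 \<le> d"
    using E_nonempty elements by (simp add: d_def Suc_le_eq card_gt_0_iff)
  define x where "x = \<epsilon> / 3"
  have x: "0 < x" "x < 1"
    using eps by (auto simp: x_def)
  define \<gamma> where "\<gamma> = x / d"
  have \<gamma>: "0 < \<gamma>"
    using x d by (simp add: \<gamma>_def)
  define c where "c = ln (1 + x)"
  have c: "0 \<le> c" "exp c - 1 = x"
    using x by (auto simp: c_def)
  define b where "b = d / \<delta>"
  have b: "1 < b"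
    using d delta True by (simp add: b_def less_divide_eq)
  define K where "K = real m * d / x * B \<epsilon> T F"
  define Good where "Good = {\<omega> \<in> space M. \<forall>f\<in>F.
           (1 - \<epsilon>) * (\<Sum>t=1..T. strategy_loss (l t \<omega>) (I t \<omega>))
             - (\<Sum>t=1..T. strategy_loss (l t \<omega>) f)
           \<le> 9 * real m * d * ln b / \<epsilon>\<^sup>2 + 3 * real m * d * B \<epsilon> T F / \<epsilon>}"
  define Bad where "Bad e = {\<omega> \<in> space M. c * (\<Sum>t=1..T. scaled_estimate \<gamma> e t \<omega>)
      \<ge> (exp c - 1) * (\<Sum>t=1..T. \<gamma> * l t \<omega> e) + ln b}" for e

  \<comment> \<open>Running the guarantee on zero losses with \<open>L = 1\<close> shows that
    \<open>B\<close> is nonnegative here, as the final arithmetic requires of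
    \<open>K\<close>.\<close>
  have "expected_approx_regret F A x T (\<lambda>_ _. 0) f0 \<le> 1 * B \<epsilon> T F"
    unfolding x_def by (rule regret_bound) (use f0 in \<open>auto simp: loss_vectors_def strategy_loss_def\<close>)
  then have "0 \<le> B \<epsilon> T F"
    by (simp add: expected_approx_regret_def strategy_loss_def)
  then have K: "0 \<le> K"
    using d x by (simp add: K_def)

  have Bad_sets: "Bad e \<in> sets M" if e: "e \<in> E" for e
  proof -
    have [measurable]: "scaled_estimate \<gamma> e t \<in> borel_measurable M" "(\<lambda>\<omega>. l t \<omega> e) \<in> borel_measurable M"
      if "t \<in> {1..T}" for t
      using measurable_from_subalg[OF subalg scaled_estimate_measurable[OF that e finite_F \<gamma>]]
        measurable_from_subalg[OF subalg loss_measurable[OF that e]] .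
    show ?thesis
      unfolding Bad_def by measurable
  qed
  have "prob (\<Union>e\<in>E. Bad e) \<le> (\<Sum>e\<in>E. prob (Bad e))"
    using elements Bad_sets by (intro finite_measure_subadditive_finite) auto
  \<comment> \<open>Since \<open>b = d / \<delta>\<close>, the \<open>d\<close> failure
    probabilities \<open>1 / b\<close> add up to \<delta>.\<close>
  also have "\<dots> \<le> (\<Sum>e\<in>E. 1 / b)"
    unfolding Bad_def using finite_F \<gamma> c b by (intro sum_mono estimate_concentration) auto
  also have "\<dots> = \<delta>"
    using d by (simp add: b_def d_def)
  finally have "1 - \<delta> \<le> 1 - prob (\<Union>e\<in>E. Bad e)"
    by simp
  also have "\<dots> = prob (space M - (\<Union>e\<in>E. Bad e))"
    using elements Bad_sets by (intro prob_compl[symmetric]) auto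
  also have "\<dots> \<le> prob Good"
  proof (rule finite_measure_mono_AE)
    have "Good = (\<Inter>f\<in>F. {\<omega> \<in> space M.
           (1 - \<epsilon>) * (\<Sum>t=1..T. strategy_loss (l t \<omega>) (I t \<omega>))
             - (\<Sum>t=1..T. strategy_loss (l t \<omega>) f)
           \<le> 9 * real m * d * ln b / \<epsilon>\<^sup>2 + 3 * real m * d * B \<epsilon> T F / \<epsilon>})"
      using f0 by (auto simp: Good_def)
    also have "\<dots> \<in> sets M"
    proof (rule sets.finite_INT[OF finite_F strategies(2)])
      fix f assume f: "f \<in> F"
      have [measurable]: "(\<lambda>\<omega>. strategy_loss (l t \<omega>) f) \<in> borel_measurable M"
        "(\<lambda>\<omega>. strategy_loss (l t \<omega>) (I t \<omega>)) \<in> borel_measurable M" if "t \<in> {1..T}" for t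
        using strategy_loss_measurable[OF that strategies(1) f]
          incurred_loss_measurable[OF that strategies(1) finite_F] .
      show "{\<omega> \<in> space M.
           (1 - \<epsilon>) * (\<Sum>t=1..T. strategy_loss (l t \<omega>) (I t \<omega>))
             - (\<Sum>t=1..T. strategy_loss (l t \<omega>) f)
           \<le> 9 * real m * d * ln b / \<epsilon>\<^sup>2 + 3 * real m * d * B \<epsilon> T F / \<epsilon>} \<in> sets M"
        by measurable
    qed
    finally show "Good \<in> sets M" .
    have "AE \<omega> in M. \<forall>t\<in>{1..T}. ?w t \<omega> (I t \<omega>) \<noteq> 0"
      by (rule AE_finite_allI[OF _ AE_draw_prob_nonzero[OF finite_F]]) auto
    then show "AE \<omega> in M. \<omega> \<in> space M - (\<Union>e\<in>E. Bad e) \<longrightarrow> \<omega> \<in> Good"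
    proof eventually_elim
      case (elim \<omega>)
      show ?case
      proof
        assume \<omega>: "\<omega> \<in> space M - (\<Union>e\<in>E. Bad e)"
        then have sp: "\<omega> \<in> space M"
          by simp
        define xh where "xh t = estimated_loss F (?w t \<omega>) (l t \<omega>) (I t \<omega>)" for t
        have drawn: "sbf_distr E F A x (\<lambda>s. l s \<omega>) (\<lambda>s. I s \<omega>) t (I t \<omega>) \<noteq> 0" if "t \<in> {1..T}" for t
          using elim that by (simp add: x_def)
        have loss: "l t \<omega> e \<in> {0..1}" if "t \<in> {1..T}" "e \<in> E" for t e
          using loss_range[OF that sp] .
        have draw: "I t \<omega> \<in> F" if "t \<in> {1..T}" for t
          using draw_in_strategies[OF that sp] .
        note prems = x elements E_nonempty strategies(1) card_le conjunct2[OF True]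
          regret_bound[folded x_def] loss draw drawn
        have observed: "\<gamma> \<le> observation_prob F (?w t \<omega>) e" if "t \<in> {1..T}" "e \<in> I t \<omega>" for t e
          unfolding \<gamma>_def d_def x_def[symmetric]
          by (rule freezing_algorithm_pathwise_regret(1)[where l = "\<lambda>s. l s \<omega>" and i = "\<lambda>s. I s \<omega>"])
            (fact prems f0(1) that)+
        have pathwise: "(1 - x)\<^sup>2 * (\<Sum>t=1..T. strategy_loss (l t \<omega>) (I t \<omega>))
            \<le> (\<Sum>t=1..T. strategy_loss (xh t) f) + K" if "f \<in> F" for f
          unfolding K_def d_def xh_def x_def[symmetric]
          by (rule freezing_algorithm_pathwise_regret(2)[where l = "\<lambda>s. l s \<omega>" and i = "\<lambda>s. I s \<omega>"])
            (fact prems that)+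
        \<comment> \<open>On this path the cut-off is inactive: drawn elements have observation
          probability at least \<gamma>, and for the others both sides are 0.\<close>
        have scaled: "scaled_estimate \<gamma> e t \<omega> = \<gamma> * xh t e" if "t \<in> {1..T}" for t e
          using observed[OF that, of e] sp by (auto simp: scaled_estimate_def xh_def estimated_loss_def)
        have element: "c * (\<Sum>t=1..T. xh t e) \<le> x * (\<Sum>t=1..T. l t \<omega> e) + ln b / \<gamma>"
          if e: "e \<in> E" for e
        proof -
          have "c * (\<Sum>t=1..T. scaled_estimate \<gamma> e t \<omega>) \<le> (exp c - 1) * (\<Sum>t=1..T. \<gamma> * l t \<omega> e) + ln b"
            using \<omega> e by (force simp: Bad_def)
          also have "(\<Sum>t=1..T. scaled_estimate \<gamma> e t \<omega>) = \<gamma> * (\<Sum>t=1..T. xh t e)"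
            unfolding sum_distrib_left using scaled by (intro sum.cong) auto
          finally have "\<gamma> * (c * (\<Sum>t=1..T. xh t e)) \<le> \<gamma> * (x * (\<Sum>t=1..T. l t \<omega> e) + ln b / \<gamma>)"
            using \<gamma> unfolding c(2) sum_distrib_left[symmetric] by (simp add: algebra_simps)
          then show ?thesis
            using \<gamma> by simp
        qed
        have "(1 - 3 * x) * (\<Sum>t=1..T. strategy_loss (l t \<omega>) (I t \<omega>)) - (\<Sum>t=1..T. strategy_loss (l t \<omega>) f)
            \<le> (real m * (ln b / \<gamma>)) / x + K" if f: "f \<in> F" for f
        proof (rule approx_regret_arith[OF x(1) _ K])
          show "0 \<le> (\<Sum>t=1..T. strategy_loss (l t \<omega>) (I t \<omega>))"
            unfolding strategy_loss_def
          proof (intro sum_nonneg)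
            fix t e assume t: "t \<in> {1..T}" and "e \<in> I t \<omega>"
            then have "e \<in> E"
              using draw_in_strategies[OF t sp] strategies by auto
            then show "0 \<le> l t \<omega> e"
              using loss_range[OF t _ sp] by auto
          qed
          show "(1 - x)\<^sup>2 * (\<Sum>t=1..T. strategy_loss (l t \<omega>) (I t \<omega>))
            \<le> (\<Sum>t=1..T. strategy_loss (xh t) f) + K"
            using pathwise[OF f] .
          \<comment> \<open>Summing over rounds first lets the bounds for single elements be added
            over \<open>f\<close>; at most \<open>m\<close> of them contribute an error
            \<open>ln b / \<gamma>\<close>.\<close>
          have swap: "(\<Sum>t=1..T. strategy_loss (y t) f) = (\<Sum>e\<in>f. \<Sum>t=1..T. y t e)" for y :: "nat \<Rightarrow> 'e \<Rightarrow> real"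
            unfolding strategy_loss_def by (rule sum.swap)
          have "c * (\<Sum>t=1..T. strategy_loss (xh t) f) = (\<Sum>e\<in>f. c * (\<Sum>t=1..T. xh t e))"
            unfolding swap by (rule sum_distrib_left)
          also have "\<dots> \<le> (\<Sum>e\<in>f. x * (\<Sum>t=1..T. l t \<omega> e) + ln b / \<gamma>)"
            using f strategies by (intro sum_mono element) auto
          also have "\<dots> = x * (\<Sum>t=1..T. strategy_loss (l t \<omega>) f) + real (card f) * (ln b / \<gamma>)"
            unfolding swap by (simp add: sum.distrib sum_distrib_left)
          also have "\<dots> \<le> x * (\<Sum>t=1..T. strategy_loss (l t \<omega>) f) + real m * (ln b / \<gamma>)"
            using card_le[OF f] b \<gamma> by (intro add_left_mono mult_right_mono) auto
          finally show "ln (1 + x) * (\<Sum>t=1..T. strategy_loss (xh t) f)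
            \<le> x * (\<Sum>t=1..T. strategy_loss (l t \<omega>) f) + real m * (ln b / \<gamma>)"
            by (simp add: c_def)
        qed
        \<comment> \<open>With \<open>\<gamma> = x / d\<close> the first term is
          \<open>m * d * ln b / x\<^sup>2\<close>, and \<open>x = \<epsilon> / 3\<close> yields the
          constants 9 and 3.\<close>
        moreover have "(real m * (ln b / \<gamma>)) / x + K = 9 * real m * d * ln b / \<epsilon>\<^sup>2 + 3 * real m * d * B \<epsilon> T F / \<epsilon>"
          by (simp add: K_def \<gamma>_def x_def power2_eq_square mult_ac)
        ultimately show "\<omega> \<in> Good"
          using sp by (simp add: Good_def x_def)
      qed
    qed
  qed
  finally show ?thesis
    by (simp add: Good_def b_def d_def)
qed

end
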